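(* Let $k\ge 1$, $\Gamma=\mathbb{Z}^k$, and let $G$ be the nilpotent Lie group and $\Psi_1,\Psi_2$ the maps defined in the context. Put $$M_1^r=\{(\vec x,Y,\vec z)\in \mathbb{R}^k\oplus M(k,\mathbb{R})\oplus\mathbb{R}^k : \vec z\neq \vec 0,\ \operatorname{rank}({}^tY,\vec z)=k\},$$ $$M_2^r=\{(X,Y)\in M(k,\mathbb{R})\oplus M(k,\mathbb{R}) : \det(Y-\lambda X)\neq 0\ \text{for any } \lambda\in\mathbb{R}\}.$$ Then $\Psi_1$ and $\Psi_2$ induce a bijection from the disjoint union $$\Psi_1\cup\Psi_2:\ M_1^r\cup M_2^r\ \longrightarrow\ R(\Gamma,G;\mathbb{R}^{k+1}),$$ where $\operatorname{Hom}(\Gamma,G)$ is regarded as a subset of $G\times\cdots\times G$ ($k$ factors) via $\varphi\mapsto(\varphi(e_1),\dots,\varphi(e_k))$.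
   Context: $M(k,\mathbb{R})$ is the set of real $k\times k$ matrices; $({}^tY,\vec z)$ is the $k\times(k+1)$ matrix obtained by appending the column $\vec z$ to ${}^tY$. $G$ is the group of real $(k+2)\times(k+2)$ matrices $\begin{pmatrix} I_k&\vec x&\vec y\\0&1&z\\0&0&1\end{pmatrix}$ with $\vec x,\vec y\in\mathbb{R}^k$, $z\in\mathbb{R}$, and $H\subset G$ is the subgroup with $\vec y=\vec 0$, $z=0$. The homogeneous space $G/H$ is identified with $\mathbb{R}^{k+1}$; $G$ acts on $\mathbb{R}^{k+1}=\mathbb{R}^k\oplus\mathbb{R}$ by the affine maps $(\vec\xi,\xi_{k+1})\mapsto(\vec\xi+\xi_{k+1}\vec x+\vec y,\ \xi_{k+1}+z)$, and $H$ is the stabilizer of the origin. $e_1,\dots,e_k$ is the standard basis of $\Gamma=\mathbb{Z}^k$. $\operatorname{Hom}(\Gamma,G)$ is the set of group homomorphisms, and $R(\Gamma,G;\mathbb{R}^{k+1})$ is the set of $\varphi\in\operatorname{Hom}(\Gamma,G)$ such that $\varphi$ is injective and $\varphi(\Gamma)$ acts properly discontinuously and freely on $\mathbb{R}^{k+1}$ (properly discontinuous: for every compact $S\subset\mathbb{R}^{k+1}$ the set $\{\gamma\in\varphi(\Gamma):\gamma S\cap S\ne\emptyset\}$ is finite). For $\vec x,\vec y\in\mathbb{R}^k$, $z\in\mathbb{R}$ put $g(\vec x,\vec y,z)=\exp\begin{pmatrix}0_k&\vec x&\vec y\\0&0&z\\0&0&0\end{pmatrix}=\begin{pmatrix}I_k&\vec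 x&\vec y+\frac12 z\vec x\\0&1&z\\0&0&1\end{pmatrix}\in G$. With $\vec y_j$ (resp. $\vec x_j$) the $j$th column of $Y$ (resp. $X$) and $\vec z={}^t(z_1,\dots,z_k)$, define $$\Psi_1(\vec x,Y,\vec z)=\bigl(g(z_j\vec x,\vec y_j,z_j)\bigr)_{1\le j\le k},\qquad \Psi_2(X,Y)=\bigl(g(\vec x_j,\vec y_j,0)\bigr)_{1\le j\le k},$$ elements of $G\times\cdots\times G$ ($k$ factors). $\Psi_1$ is defined on triples with $\vec z\ne\vec 0$, $\Psi_2$ on all pairs $(X,Y)$. *)

theory Defs
  imports "HOL-Analysis.Analysis" "HOL-Algebra.Group"
begin

text \<open>
  The dimension is \<^term>\<open>CARD('k)\<close> for a finite index type \<open>'k\<close> (types are nonempty, so it is at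
  least 1). The index type \<^typ>\<open>'k option option\<close> has \<open>CARD('k) + 2\<close> elements:
  \<open>Some (Some i)\<close> are the first \<open>CARD('k)\<close> rows and columns, \<open>Some None\<close> is the last but one,
  \<open>None\<close> is the last. Note that \<open>^\<close> on matrices would be the componentwise power; matrix products
  and powers are written with \<open>**\<close>.
\<close>

type_synonym 'k gmat = "real ^ 'k option option ^ 'k option option"

text \<open>The block matrix with rows \<open>(c I, x, y)\<close>, \<open>(0, c, z)\<close>, \<open>(0, 0, c)\<close>.\<close>

definition block_mat :: "real \<Rightarrow> real ^ 'k \<Rightarrow> real ^ 'k \<Rightarrow> real \<Rightarrow> 'k::finite gmat" where
  "block_mat c x y z = (\<chi> i j. case (i, j) of
       (Some (Some p), Some (Some q)) \<Rightarrow> (if p = q then c else 0)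
     | (Some (Some p), Some None) \<Rightarrow> x $ p
     | (Some (Some p), None) \<Rightarrow> y $ p
     | (Some None, Some None) \<Rightarrow> c
     | (Some None, None) \<Rightarrow> z
     | (None, None) \<Rightarrow> c
     | _ \<Rightarrow> 0)"

definition nilG :: "'k::finite gmat monoid" where
  "nilG = \<lparr>carrier = {block_mat 1 x y z | x y z. True}, mult = (**), one = mat 1\<rparr>"

definition act :: "'k::finite gmat \<Rightarrow> (real ^ 'k) \<times> real \<Rightarrow> (real ^ 'k) \<times> real" where
  "act A = (\<lambda>(\<xi>, t).
     (\<xi> + t *\<^sub>R (\<chi> i. A $ Some (Some i) $ Some None) + (\<chi> i. A $ Some (Some i) $ None),
      t + A $ Some None $ None))"

definition Gamma :: "(int ^ 'k::finite) monoid" where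
  "Gamma = \<lparr>carrier = UNIV, mult = (+), one = 0\<rparr>"

definition properly_discontinuous :: "'k::finite gmat set \<Rightarrow> bool" where
  "properly_discontinuous L \<longleftrightarrow>
     (\<forall>S. compact S \<longrightarrow> finite {\<gamma> \<in> L. act \<gamma> ` S \<inter> S \<noteq> {}})"

definition acts_freely :: "'k::finite gmat set \<Rightarrow> bool" where
  "acts_freely L \<longleftrightarrow> (\<forall>\<gamma>\<in>L. \<forall>p. act \<gamma> p = p \<longrightarrow> \<gamma> = mat 1)"

definition R_set :: "(int ^ 'k::finite \<Rightarrow> 'k gmat) set" where
  "R_set = {\<phi> \<in> hom Gamma nilG. inj \<phi> \<and> properly_discontinuous (range \<phi>) \<and> acts_freely (range \<phi>)}"

text \<open>The embedding of \<^term>\<open>hom Gamma nilG\<close> into the product of copies of \<open>nilG\<close>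
  indexed by \<open>'k\<close>, see \<open>inj_on_gens\<close> below.\<close>

definition gens :: "(int ^ 'k::finite \<Rightarrow> 'k gmat) \<Rightarrow> 'k \<Rightarrow> 'k gmat" where
  "gens \<phi> = (\<lambda>j. \<phi> (axis j 1))"

definition mat_exp :: "real ^ 'n ^ 'n::finite \<Rightarrow> real ^ 'n ^ 'n" where
  "mat_exp A = (\<Sum>n. (1 / fact n) *\<^sub>R (((**) A ^^ n) (mat 1)))"

definition gelt :: "real ^ 'k \<Rightarrow> real ^ 'k \<Rightarrow> real \<Rightarrow> 'k::finite gmat" where
  "gelt x y z = mat_exp (block_mat 0 x y z)"

definition \<Psi>\<^sub>1 :: "(real ^ 'k) \<times> (real ^ 'k ^ 'k) \<times> (real ^ 'k) \<Rightarrow> 'k \<Rightarrow> 'k::finite gmat" where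
  "\<Psi>\<^sub>1 = (\<lambda>(x, Y, z). \<lambda>j. gelt (z $ j *\<^sub>R x) (column j Y) (z $ j))"

definition \<Psi>\<^sub>2 :: "(real ^ 'k ^ 'k) \<times> (real ^ 'k ^ 'k) \<Rightarrow> 'k \<Rightarrow> 'k::finite gmat" where
  "\<Psi>\<^sub>2 = (\<lambda>(X, Y). \<lambda>j. gelt (column j X) (column j Y) 0)"

definition append_col :: "real ^ 'n ^ 'm \<Rightarrow> real ^ 'm \<Rightarrow> real ^ 'n::finite option ^ 'm" where
  "append_col A z = (\<chi> i j. case j of Some q \<Rightarrow> A $ i $ q | None \<Rightarrow> z $ i)"

definition M\<^sub>1\<^sub>r :: "((real ^ 'k) \<times> (real ^ 'k ^ 'k) \<times> (real ^ 'k::finite)) set" where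
  "M\<^sub>1\<^sub>r = {(x, Y, z). z \<noteq> 0 \<and> rank (append_col (transpose Y) z) = CARD('k)}"

definition M\<^sub>2\<^sub>r :: "((real ^ 'k ^ 'k) \<times> (real ^ 'k ^ 'k::finite)) set" where
  "M\<^sub>2\<^sub>r = {(X, Y). \<forall>l::real. det (Y - l *\<^sub>R X) \<noteq> 0}"


lemma sum_option_UNIV:
  "(\<Sum>i\<in>UNIV. f i) = f None + (\<Sum>i\<in>UNIV. f (Some i))" for f :: "'a::finite option \<Rightarrow> real"
  by (simp add: UNIV_option_conv sum.reindex)

lemma block_mat_mult:
  "block_mat c x y z ** block_mat d x' y' z' =
   block_mat (c * d) (c *\<^sub>R x' + d *\<^sub>R x) (c *\<^sub>R y' + z' *\<^sub>R x + d *\<^sub>R y) (c * z' + d * z)"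
  by (simp add: vec_eq_iff matrix_matrix_mult_def block_mat_def sum_option_UNIV if_distrib
        if_distribR sum.If_cases mult.commute split: option.splits cong: if_cong)

lemma block_mat_one: "block_mat 1 0 0 0 = mat 1"
  by (simp add: vec_eq_iff block_mat_def mat_def split: option.splits)

lemma group_nilG: "group (nilG :: 'k::finite gmat monoid)"
proof (rule groupI)
  fix A :: "'k gmat" assume "A \<in> carrier nilG"
  then obtain x y z where A: "A = block_mat 1 x y z" by (auto simp: nilG_def)
  show "\<exists>B\<in>carrier nilG. B \<otimes>\<^bsub>nilG\<^esub> A = \<one>\<^bsub>nilG\<^esub>"
    by (rule bexI[of _ "block_mat 1 (- x) (z *\<^sub>R x - y) (- z)"])
      (auto simp: A nilG_def block_mat_mult simp flip: block_mat_one)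
next
  show "\<one>\<^bsub>nilG\<^esub> \<in> carrier (nilG :: 'k gmat monoid)"
    by (auto simp: nilG_def simp flip: block_mat_one)
qed (fastforce simp: nilG_def matrix_mul_assoc block_mat_mult)+

lemma group_Gamma: "group (Gamma :: (int ^ 'k::finite) monoid)"
  by (rule groupI) (auto simp: Gamma_def add.assoc intro: exI[of _ "- _"])

lemma act_block_mat: "act (block_mat 1 x y z) (\<xi>, t) = (\<xi> + t *\<^sub>R x + y, t + z)"
  by (simp add: act_def block_mat_def vec_eq_iff)

lemma act_mult:
  assumes "A \<in> carrier nilG" "B \<in> carrier nilG"
  shows "act (A ** B) p = act A (act B p)"
  using assms
  by (cases p) (auto simp: nilG_def block_mat_mult act_block_mat algebra_simps)

lemma gelt_eq: "gelt x y z = block_mat 1 x (y + (z / 2) *\<^sub>R x) z"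
proof -
  let ?A = "block_mat 0 x y z"
  let ?P = "\<lambda>n. ((**) ?A ^^ n) (mat 1)"
  have z: "block_mat 0 0 0 0 = (0 :: 'a gmat)"
    by (simp add: vec_eq_iff block_mat_def split: option.splits)
  have P0: "?P (n + 3) = 0" for n
  proof (induction n)
    case 0
    show ?case by (simp add: numeral_3_eq_3 block_mat_mult z)
  next
    case (Suc n)
    have "?P (Suc n + 3) = ?A ** ?P (n + 3)"
      by (simp only: add_Suc funpow.simps o_apply)
    also have "\<dots> = 0"
      unfolding Suc.IH by (simp add: matrix_matrix_mult_def vec_eq_iff)
    finally show ?case .
  qed
  have "mat_exp ?A = (\<Sum>n<3. (1 / fact n) *\<^sub>R ?P n)"
    unfolding mat_exp_def
  proof (rule suminf_finite)
    fix n :: nat assume "n \<notin> {..<3}"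
    then show "(1 / fact n) *\<^sub>R ?P n = 0" using P0[of "n - 3"] by simp
  qed simp
  also have "\<dots> = mat 1 + ?A + (1 / 2) *\<^sub>R (?A ** ?A)"
    by (simp add: numeral_3_eq_3)
  also have "\<dots> = block_mat 1 x (y + (z / 2) *\<^sub>R x) z"
    unfolding block_mat_mult block_mat_one[symmetric]
    by (simp add: vec_eq_iff block_mat_def split: option.splits)
  finally show ?thesis by (simp add: gelt_def)
qed

lemma inj_on_gens: "inj_on gens (hom Gamma (nilG :: 'k::finite gmat monoid))"
proof (rule inj_onI)
  fix \<phi> \<psi> :: "int ^ 'k \<Rightarrow> 'k gmat"
  assume h: "\<phi> \<in> hom Gamma nilG" "\<psi> \<in> hom Gamma nilG" and eq: "gens \<phi> = gens \<psi>"
  interpret p: group_hom Gamma nilG \<phi>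
    using h by (simp add: group_hom_def group_hom_axioms_def group_Gamma group_nilG)
  interpret q: group_hom Gamma nilG \<psi>
    using h by (simp add: group_hom_def group_hom_axioms_def group_Gamma group_nilG)
  define E where "E = {v. \<phi> v = \<psi> v}"
  have E0: "0 \<in> E"
    using p.hom_one q.hom_one by (simp add: E_def Gamma_def)
  have Eadd: "v + w \<in> E" if "v \<in> E" "w \<in> E" for v w
    using that p.hom_mult[of v w] q.hom_mult[of v w] by (simp add: E_def Gamma_def)
  have inv: "inv\<^bsub>Gamma\<^esub> v = - v" for v :: "int ^ 'k"
    by (rule p.G.inv_equality) (simp_all add: Gamma_def)
  have Eneg: "- v \<in> E" if "v \<in> E" for v
    using that p.hom_inv[of v] q.hom_inv[of v] unfolding inv by (simp add: E_def Gamma_def)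
  have Enat: "axis j (int n) \<in> E" for j n
  proof (induction n)
    case 0
    have "axis j (int 0) = (0 :: int ^ 'k)"
      by (simp add: vec_eq_iff axis_def)
    with E0 show ?case by (simp only:)
  next
    case (Suc n)
    have "axis j (int (Suc n)) = axis j 1 + axis j (int n)"
      by (simp add: vec_eq_iff axis_def)
    moreover have "axis j 1 \<in> E"
      using fun_cong[OF eq, of j] by (simp add: E_def gens_def)
    ultimately show ?case using Suc Eadd by simp
  qed
  have Eint: "axis j m \<in> E" for j m
  proof (cases "m \<ge> 0")
    case True
    then show ?thesis using Enat[of j "nat m"] by simp
  next
    case False
    have "axis j m = - axis j (int (nat (- m)))"
      using False by (simp add: vec_eq_iff axis_def)
    then show ?thesis using Eneg[OF Enat] by (simp only:)
  qed
  have "(\<Sum>j\<in>J. axis j (v $ j)) \<in> E" if "finite J" for J v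
    using that by (induction J) (auto intro: E0 Eadd Eint)
  moreover have "v = (\<Sum>j\<in>UNIV. axis j (v $ j))" for v :: "int ^ 'k"
    by (simp add: vec_eq_iff axis_def)
  ultimately have "v \<in> E" for v by (metis finite_code)
  then show "\<phi> = \<psi>" by (auto simp: E_def)
qed

end

theory Submission
  imports Defs
begin

text \<open>
  Two elements \<open>g(x, y, z)\<close> and \<open>g(x', y', z')\<close> commute iff \<open>z' x = z x'\<close>, and then their logarithms
  add. Hence every homomorphism has the form \<open>n \<mapsto> g(X n, Y n, z \<bullet> n)\<close>, where either \<open>z = 0\<close> or all
  columns of \<open>X\<close> are the multiples \<open>z\<^sub>j x\<close> of one vector. It moves \<open>(\<xi>, t)\<close> by
  \<open>((Y + s X) n, z \<bullet> n)\<close> with \<open>s = t + (z \<bullet> n) / 2\<close>. If no \<open>v \<noteq> 0\<close> satisfies \<open>z \<bullet> v = 0\<close> and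
  \<open>(Y + s X) v = 0\<close> for some \<open>s\<close>, then by compactness this displacement grows linearly in \<open>n\<close>,
  uniformly for bounded \<open>t\<close>, so the action is free and properly discontinuous. Conversely, the integer points
  near the line spanned by such a \<open>v\<close> all move \<open>(0, s)\<close> within a compact set. For the two
  families the criterion becomes the rank and the determinant condition.
\<close>

section \<open>Exponential coordinates on the group and its action\<close>

lemma block_mat_eq_iff:
  "block_mat c x y z = block_mat c x' y' z' \<longleftrightarrow> x = x' \<and> y = y' \<and> z = z'"
  for x :: "real ^ 'k::finite"
proof
  assume eq: "block_mat c x y z = block_mat c x' y' z'"
  have "x $ p = x' $ p" for p
    using arg_cong[OF eq, of "\<lambda>A. A $ Some (Some p) $ Some None"] by (simp add: block_mat_def)
  moreover have "y $ p = y' $ p" for p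
    using arg_cong[OF eq, of "\<lambda>A. A $ Some (Some p) $ None"] by (simp add: block_mat_def)
  moreover have "z = z'"
    using arg_cong[OF eq, of "\<lambda>A. A $ Some None $ None"] by (simp add: block_mat_def)
  ultimately show "x = x' \<and> y = y' \<and> z = z'" by (simp add: vec_eq_iff)
qed simp

lemma gelt_eq_iff: "gelt x y z = gelt x' y' z' \<longleftrightarrow> x = x' \<and> y = y' \<and> z = z'"
  by (auto simp: gelt_eq block_mat_eq_iff)

lemma gelt_zero: "gelt 0 0 0 = mat 1"
  by (simp add: gelt_eq block_mat_one)

lemma carrier_nilG_gelt: "carrier nilG = {gelt x y z | x y z. True}"
proof -
  have "block_mat 1 x y z = gelt x (y - (z / 2) *\<^sub>R x) z" for x y :: "real ^ 'a" and z
    by (simp add: gelt_eq)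
  then have "\<exists>x' y' z'. block_mat 1 x y z = gelt x' y' z'" for x y :: "real ^ 'a" and z
    by blast
  moreover have "\<exists>x' y' z'. gelt x y z = block_mat 1 x' y' z'" for x y :: "real ^ 'a" and z
    using gelt_eq by blast
  ultimately show ?thesis
    unfolding nilG_def by auto
qed

text \<open>The hypothesis says that the logarithms commute: the commutator of the two nilpotent
  matrices has the single block \<open>z' x - z x'\<close>.\<close>

lemma gelt_mult:
  assumes "z *\<^sub>R x' = z' *\<^sub>R x"
  shows "gelt x y z ** gelt x' y' z' = gelt (x + x') (y + y') (z + z')"
proof -
  have "z * x' $ i = z' * x $ i" for i
    using arg_cong[OF assms, of "\<lambda>v. v $ i"] by simp
  then show ?thesis
    by (simp add: gelt_eq block_mat_mult block_mat_eq_iff) (simp add: vec_eq_iff field_simps)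
qed

lemma gelt_commute_iff:
  "gelt x y z ** gelt x' y' z' = gelt x' y' z' ** gelt x y z \<longleftrightarrow> z *\<^sub>R x' = z' *\<^sub>R x"
  by (simp add: gelt_eq block_mat_mult block_mat_eq_iff) (auto simp: vec_eq_iff field_simps)

text \<open>\<open>t + z / 2\<close> is the mean of the old and the new height; it is the source of
  the parameter \<open>s\<close> below.\<close>

lemma act_gelt: "act (gelt x y z) (\<xi>, t) = (\<xi> + (y + (t + z / 2) *\<^sub>R x), t + z)"
  by (simp add: gelt_eq act_block_mat algebra_simps)

section \<open>Lattice points in real space\<close>

definition real_vec :: "int ^ 'k \<Rightarrow> real ^ 'k" where
  "real_vec n = (\<chi> i. real_of_int (n $ i))"

lemma real_vec_add: "real_vec (m + n) = real_vec m + real_vec n"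
  by (simp add: real_vec_def vec_eq_iff)

lemma real_vec_axis: "real_vec (axis j 1) = axis j 1"
  by (simp add: real_vec_def vec_eq_iff axis_def)

lemma finite_real_vec_bounded: "finite {n :: int ^ 'k::finite. norm (real_vec n) \<le> B}"
proof -
  let ?A = "{n :: int ^ 'k. norm (real_vec n) \<le> B}"
  have "n $ i \<in> {- \<lceil>B\<rceil>..\<lceil>B\<rceil>}" if "n \<in> ?A" for n i
  proof -
    have "\<bar>real_of_int (n $ i)\<bar> \<le> B"
      using component_le_norm_cart[of "real_vec n" i] that by (simp add: real_vec_def)
    then show ?thesis by (simp add: abs_le_iff) linarith
  qed
  then have "vec_nth ` ?A \<subseteq> PiE UNIV (\<lambda>_. {- \<lceil>B\<rceil>..\<lceil>B\<rceil>})"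
    by (auto simp: PiE_UNIV_domain)
  then have "finite (vec_nth ` ?A)"
    by (rule finite_subset) (simp add: finite_PiE)
  then show ?thesis
    by (rule finite_imageD) (simp add: inj_on_def vec_nth_inject)
qed

text \<open>Rounding down costs at most 1 per coordinate. This supplies lattice points at bounded
  distance from a line.\<close>

lemma real_vec_approx:
  obtains n :: "int ^ 'k::finite" where "norm (real_vec n - v) \<le> real CARD('k)"
proof
  let ?n = "\<chi> i. \<lfloor>v $ i\<rfloor>"
  have "norm (real_vec ?n - v) \<le> (\<Sum>i\<in>UNIV. \<bar>(real_vec ?n - v) $ i\<bar>)"
    by (rule norm_le_l1_cart)
  also have "\<dots> \<le> (\<Sum>i\<in>(UNIV :: 'k set). 1)"
    by (rule sum_mono) (simp add: real_vec_def, linarith)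
  finally show "norm (real_vec ?n - v) \<le> real CARD('k)" by simp
qed

section \<open>Homomorphisms with linear logarithm\<close>

definition lin_hom :: "real ^ 'k ^ 'k \<Rightarrow> real ^ 'k ^ 'k \<Rightarrow> real ^ 'k \<Rightarrow> int ^ 'k \<Rightarrow> 'k::finite gmat"
  where "lin_hom X Y z n = gelt (X *v real_vec n) (Y *v real_vec n) (z \<bullet> real_vec n)"

lemma gens_lin_hom: "gens (lin_hom X Y z) = (\<lambda>j. gelt (column j X) (column j Y) (z $ j))"
  by (simp add: gens_def lin_hom_def real_vec_axis matrix_vector_mult_basis inner_axis)

text \<open>By \<open>comm\<close> all values have commuting logarithms, so these add. It is stated
  for real vectors because it is later applied to a real kernel vector.\<close>

lemma lin_hom_in_hom:
  assumes comm: "\<And>v w. (z \<bullet> v) *\<^sub>R (X *v w) = (z \<bullet> w) *\<^sub>R (X *v v)"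
  shows "lin_hom X Y z \<in> hom Gamma nilG"
proof (rule homI)
  show "lin_hom X Y z n \<in> carrier nilG" for n
    by (auto simp: lin_hom_def carrier_nilG_gelt)
  show "lin_hom X Y z (m \<otimes>\<^bsub>Gamma\<^esub> n) = lin_hom X Y z m \<otimes>\<^bsub>nilG\<^esub> lin_hom X Y z n" for m n
    by (simp add: Gamma_def nilG_def lin_hom_def gelt_mult comm real_vec_add
        matrix_vector_right_distrib inner_add_right)
qed

text \<open>A nonzero \<open>v\<close> violating this for some \<open>s\<close> spans a
  one-parameter group that fixes every point at height \<open>s\<close>. The condition is thus
  freeness for real vectors in place of integer ones.\<close>

definition nondegenerate :: "real ^ 'k ^ 'k \<Rightarrow> real ^ 'k ^ 'k \<Rightarrow> real ^ 'k \<Rightarrow> bool" where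
  "nondegenerate X Y z \<longleftrightarrow>
     (\<forall>s v. z \<bullet> v = 0 \<and> Y *v v + s *\<^sub>R (X *v v) = 0 \<longrightarrow> v = 0)"

section \<open>Nondegeneracy gives a free and proper action\<close>

lemma nondegenerate_lower_bound:
  fixes X Y :: "real ^ 'k ^ 'k::finite"
  assumes nd: "nondegenerate X Y z" and "R \<ge> 0"
  obtains c where "c > 0"
    "\<And>s v. \<bar>s\<bar> \<le> R \<Longrightarrow> c * norm v \<le> norm (Y *v v + s *\<^sub>R (X *v v)) + \<bar>z \<bullet> v\<bar>"
proof -
  \<comment> \<open>\<open>f\<close> is continuous and has no zero on a compact set, so its minimum
    there serves as \<open>c\<close>; homogeneity in \<open>v\<close> extends the bound from the
    unit sphere.\<close>
  define f where "f = (\<lambda>(s, v). norm (Y *v v + s *\<^sub>R (X *v v)) + \<bar>z \<bullet> v\<bar>)"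
  let ?K = "{-R..R} \<times> sphere (0 :: real ^ 'k) 1"
  have "compact ?K" by (intro compact_Times) auto
  \<comment> \<open>Index types are nonempty, so any basis vector, here at the arbitrary index
    \<open>undefined\<close>, is a point of the sphere.\<close>
  moreover have "axis undefined 1 \<in> sphere (0 :: real ^ 'k) 1" by simp
  then have "?K \<noteq> {}" using \<open>R \<ge> 0\<close> by auto
  moreover have "continuous_on ?K f"
    unfolding f_def case_prod_unfold
    by (intro continuous_intros matrix_vector_mult_linear_continuous_on
        linear_continuous_on_compose[OF continuous_on_snd[OF continuous_on_id]]) auto
  ultimately obtain s0 v0 where s0: "(s0, v0) \<in> ?K" and le: "\<forall>p\<in>?K. f (s0, v0) \<le> f p"
    using continuous_attains_inf[of ?K f] by (metis surj_pair)
  have "f (s0, v0) \<noteq> 0"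
  proof
    assume "f (s0, v0) = 0"
    then have "Y *v v0 + s0 *\<^sub>R (X *v v0) = 0" "z \<bullet> v0 = 0"
      by (auto simp: f_def add_nonneg_eq_0_iff)
    with nd have "v0 = 0" unfolding nondegenerate_def by blast
    with s0 show False by simp
  qed
  moreover have "f (s0, v0) \<ge> 0" by (simp add: f_def)
  ultimately have "f (s0, v0) > 0" by simp
  moreover have "f (s0, v0) * norm v \<le> norm (Y *v v + s *\<^sub>R (X *v v)) + \<bar>z \<bullet> v\<bar>"
    if "\<bar>s\<bar> \<le> R" for s v
  proof (cases "v = 0")
    case False
    define u where "u = v /\<^sub>R norm v"
    have v: "v = norm v *\<^sub>R u" and "norm u = 1" using False by (simp_all add: u_def)
    then have "f (s0, v0) \<le> f (s, u)" using le that by (simp add: abs_le_iff)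
    then have "f (s0, v0) * norm v \<le> norm v * f (s, u)"
      by (simp add: mult.commute mult_left_mono)
    also have "\<dots> = \<bar>norm v\<bar> * norm (Y *v u + s *\<^sub>R (X *v u)) + \<bar>norm v * (z \<bullet> u)\<bar>"
      by (simp add: f_def distrib_left abs_mult)
    also have "\<dots> = norm (Y *v (norm v *\<^sub>R u) + s *\<^sub>R (X *v (norm v *\<^sub>R u)))
        + \<bar>z \<bullet> (norm v *\<^sub>R u)\<bar>"
      by (simp only: matrix_vector_mult_scaleR inner_scaleR_right norm_scaleR[symmetric]
          scaleR_right_distrib scaleR_left_commute)
    finally show ?thesis using v by simp
  qed simp
  ultimately show ?thesis using that by blast
qed

lemma lin_hom_properly_discontinuous:
  fixes X Y :: "real ^ 'k ^ 'k::finite"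
  assumes "nondegenerate X Y z"
  shows "properly_discontinuous (range (lin_hom X Y z))"
  unfolding properly_discontinuous_def
proof (intro allI impI)
  fix S :: "((real ^ 'k) \<times> real) set"
  assume "compact S"
  then obtain r where "r > 0" and r: "\<And>p. p \<in> S \<Longrightarrow> norm p \<le> r"
    using compact_imp_bounded bounded_pos by metis
  obtain c where "c > 0"
    and c: "\<And>s v. \<bar>s\<bar> \<le> 2 * r \<Longrightarrow> c * norm v \<le> norm (Y *v v + s *\<^sub>R (X *v v)) + \<bar>z \<bullet> v\<bar>"
    using nondegenerate_lower_bound[OF assms, of "2 * r"] \<open>r > 0\<close> by auto
  \<comment> \<open>Two points of norm at most \<open>r\<close> differ by at most
    \<open>2 * r\<close> in each component, and the two components add up to \<open>4 * r\<close>.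
    The mean height \<open>s\<close> stays within \<open>2 * r\<close>.\<close>
  have "norm (real_vec n) \<le> 4 * r / c" if "act (lin_hom X Y z n) ` S \<inter> S \<noteq> {}" for n
  proof -
    let ?v = "real_vec n"
    obtain \<xi> t where p: "(\<xi>, t) \<in> S" "act (lin_hom X Y z n) (\<xi>, t) \<in> S"
      using \<open>act (lin_hom X Y z n) ` S \<inter> S \<noteq> {}\<close> by auto
    define s where "s = t + (z \<bullet> ?v) / 2"
    let ?d = "Y *v ?v + s *\<^sub>R (X *v ?v)"
    have q: "(\<xi> + ?d, t + z \<bullet> ?v) \<in> S"
      using p(2) by (simp add: lin_hom_def act_gelt s_def)
    have "norm \<xi> \<le> r" "\<bar>t\<bar> \<le> r"
      using r[OF p(1)] norm_fst_le[of \<xi> t] norm_snd_le[of t \<xi>] by auto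
    moreover have "norm (\<xi> + ?d) \<le> r" "\<bar>t + z \<bullet> ?v\<bar> \<le> r"
      using r[OF q] norm_fst_le[of "\<xi> + ?d" "t + z \<bullet> ?v"] norm_snd_le[of "t + z \<bullet> ?v" "\<xi> + ?d"]
      by auto
    ultimately have "norm ?d \<le> 2 * r" "\<bar>z \<bullet> ?v\<bar> \<le> 2 * r" "\<bar>s\<bar> \<le> 2 * r"
      using norm_triangle_ineq4[of "\<xi> + ?d" \<xi>] by (auto simp: s_def)
    then have "c * norm ?v \<le> 4 * r" using c[of s ?v] by linarith
    then show ?thesis using \<open>c > 0\<close> by (simp add: field_simps)
  qed
  then have "{\<gamma> \<in> range (lin_hom X Y z). act \<gamma> ` S \<inter> S \<noteq> {}}
      \<subseteq> lin_hom X Y z ` {n. norm (real_vec n) \<le> 4 * r / c}"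
    by blast
  then show "finite {\<gamma> \<in> range (lin_hom X Y z). act \<gamma> ` S \<inter> S \<noteq> {}}"
    by (rule finite_subset) (simp add: finite_real_vec_bounded)
qed

text \<open>At a fixed point the height does not change, so \<open>s\<close> is the height
  \<open>t\<close> itself.\<close>

lemma lin_hom_fixed_point:
  assumes "nondegenerate X Y z" "act (lin_hom X Y z n) p = p"
  shows "n = 0"
proof -
  obtain \<xi> t where "p = (\<xi>, t)" by force
  with assms(2) have "z \<bullet> real_vec n = 0" "Y *v real_vec n + t *\<^sub>R (X *v real_vec n) = 0"
    by (auto simp: lin_hom_def act_gelt)
  with assms(1) have "real_vec n = 0" unfolding nondegenerate_def by blast
  then show ?thesis by (simp add: real_vec_def vec_eq_iff)
qed

lemma lin_hom_zero: "lin_hom X Y z 0 = mat 1"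
proof -
  have "real_vec 0 = (0 :: real ^ 'a)" by (simp add: real_vec_def vec_eq_iff)
  then show ?thesis by (simp add: lin_hom_def gelt_zero)
qed

lemma lin_hom_acts_freely:
  assumes "nondegenerate X Y z"
  shows "acts_freely (range (lin_hom X Y z))"
  unfolding acts_freely_def
  using lin_hom_fixed_point[OF assms] lin_hom_zero by blast

text \<open>Equal values have equal logarithms, which are linear in \<open>n\<close>; hence the
  difference is sent to the identity, which fixes the origin.\<close>

lemma inj_lin_hom:
  assumes "nondegenerate X Y z"
  shows "inj (lin_hom X Y z)"
proof (rule injI)
  fix m n assume "lin_hom X Y z m = lin_hom X Y z n"
  then have eq: "X *v real_vec m = X *v real_vec n" "Y *v real_vec m = Y *v real_vec n"
      "z \<bullet> real_vec m = z \<bullet> real_vec n"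
    by (auto simp: lin_hom_def gelt_eq_iff)
  have "real_vec (m - n) = real_vec m - real_vec n"
    by (simp add: real_vec_def vec_eq_iff)
  with eq have "lin_hom X Y z (m - n) = mat 1"
    by (simp add: lin_hom_def matrix_vector_mult_diff_distrib inner_diff_right gelt_zero)
  then have "act (lin_hom X Y z (m - n)) (0, 0) = (0, 0)"
    by (simp add: act_block_mat flip: block_mat_one)
  from lin_hom_fixed_point[OF assms this] show "m = n" by simp
qed

section \<open>A proper action forces nondegeneracy\<close>

lemma properly_discontinuous_imp_nondegenerate:
  fixes X Y :: "real ^ 'k ^ 'k::finite"
  assumes comm: "\<And>v w. (z \<bullet> v) *\<^sub>R (X *v w) = (z \<bullet> w) *\<^sub>R (X *v v)"
    and inj: "inj (lin_hom X Y z)"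
    and pd: "properly_discontinuous (range (lin_hom X Y z))"
  shows "nondegenerate X Y z"
  unfolding nondegenerate_def
proof (intro allI impI, elim conjE)
  fix s :: real and v :: "real ^ 'k"
  assume zv: "z \<bullet> v = 0" and Yv: "Y *v v + s *\<^sub>R (X *v v) = 0"
  \<comment> \<open>\<open>F e\<close> is where the real vector \<open>e\<close> would move
    \<open>(0, s)\<close>; translating \<open>e\<close> along \<open>v\<close> leaves it
    unchanged.\<close>
  define F where "F e = (Y *v e + (s + (z \<bullet> e) / 2) *\<^sub>R (X *v e), s + z \<bullet> e)" for e
  have F: "act (lin_hom X Y z n) (0, s) = F (real_vec n - a *\<^sub>R v)" for n a
  proof -
    define e where "e = real_vec n - a *\<^sub>R v"
    have n: "real_vec n = e + a *\<^sub>R v" by (simp add: e_def)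
    \<comment> \<open>The cross term vanishes: \<open>comm\<close> and
      \<open>z \<bullet> v = 0\<close> give
      \<open>(z \<bullet> e) *\<^sub>R (X *v v) = 0\<close>.\<close>
    have "(a * (z \<bullet> e) / 2) *\<^sub>R (X *v v) = 0" using comm[of e v] zv by auto
    moreover have "a *\<^sub>R (Y *v v) + (a * s) *\<^sub>R (X *v v) = 0"
      using arg_cong[OF Yv, of "scaleR a"] by (simp add: scaleR_right_distrib)
    ultimately have "Y *v (e + a *\<^sub>R v) + (s + (z \<bullet> e) / 2) *\<^sub>R (X *v (e + a *\<^sub>R v))
        = Y *v e + (s + (z \<bullet> e) / 2) *\<^sub>R (X *v e)"
      by (simp add: matrix_vector_right_distrib matrix_vector_mult_scaleR algebra_simps
          del: scaleR_eq_0_iff)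
    then show ?thesis
      unfolding e_def[symmetric] using zv
      by (simp add: lin_hom_def act_gelt n F_def inner_add_right)
  qed
  define K where "K = real CARD('k)"
  define S where "S = F ` cball 0 K"
  have "compact S"
    unfolding S_def F_def
    by (intro compact_continuous_image compact_cball continuous_intros
        matrix_vector_mult_linear_continuous_on) auto
  \<comment> \<open>This is \<open>F 0\<close>. With \<open>(0, s)\<close> in \<open>S\<close>,
    every \<open>n\<close> that sends it into \<open>S\<close> makes \<open>S\<close> meet its
    image.\<close>
  have S0: "(0, s) \<in> S"
    unfolding S_def by (rule image_eqI[of _ _ 0]) (simp_all add: F_def K_def)
  let ?N = "{n. act (lin_hom X Y z n) (0, s) \<in> S}"
  have "lin_hom X Y z ` ?N \<subseteq> {\<gamma> \<in> range (lin_hom X Y z). act \<gamma> ` S \<inter> S \<noteq> {}}"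
    using S0 by blast
  then have "finite (lin_hom X Y z ` ?N)"
    using pd \<open>compact S\<close> finite_subset unfolding properly_discontinuous_def by blast
  then have "finite ?N"
    by (rule finite_imageD) (rule inj_on_subset[OF inj], simp)
  then obtain C where C: "\<And>n. n \<in> ?N \<Longrightarrow> norm (real_vec n) \<le> C"
    using finite_imp_bounded[OF finite_imageI, of ?N real_vec] unfolding bounded_iff by blast
  \<comment> \<open>The lattice point near \<open>a *\<^sub>R v\<close> lies in the finite set
    \<open>?N\<close>, so the ray along \<open>v\<close> stays bounded, which forces
    \<open>v = 0\<close>.\<close>
  have bound: "a * norm v \<le> C + K" if "a \<ge> 0" for a
  proof -
    obtain n :: "int ^ 'k" where n: "norm (real_vec n - a *\<^sub>R v) \<le> K"
      unfolding K_def by (rule real_vec_approx)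
    then have "n \<in> ?N" by (auto simp: F[of n a] S_def)
    then have "norm (real_vec n) \<le> C" by (rule C)
    moreover have "norm (a *\<^sub>R v) \<le> norm (real_vec n) + norm (real_vec n - a *\<^sub>R v)"
      using norm_triangle_ineq4[of "real_vec n" "real_vec n - a *\<^sub>R v"] by simp
    ultimately show ?thesis using n that by simp
  qed
  show "v = 0"
  proof (rule ccontr)
    assume "v \<noteq> 0"
    then obtain m :: nat where "C + K < real m * norm v"
      using reals_Archimedean3[of "norm v"] by auto
    with bound[of "real m"] show False by simp
  qed
qed

lemma lin_hom_in_R_set_iff:
  assumes "\<And>v w. (z \<bullet> v) *\<^sub>R (X *v w) = (z \<bullet> w) *\<^sub>R (X *v v)"
  shows "lin_hom X Y z \<in> R_set \<longleftrightarrow> nondegenerate X Y z"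
  using properly_discontinuous_imp_nondegenerate[OF assms] lin_hom_in_hom[OF assms]
    lin_hom_properly_discontinuous lin_hom_acts_freely inj_lin_hom
  unfolding R_set_def by blast

lemma hom_eq_lin_hom_iff:
  assumes "\<phi> \<in> hom Gamma nilG"
    and "\<And>v w. (z \<bullet> v) *\<^sub>R (X *v w) = (z \<bullet> w) *\<^sub>R (X *v v)"
  shows "\<phi> = lin_hom X Y z \<longleftrightarrow> gens \<phi> = gens (lin_hom X Y z)"
  using inj_on_gens assms(1) lin_hom_in_hom[OF assms(2)] unfolding inj_on_def by metis

section \<open>The rank and determinant conditions\<close>

text \<open>The product of the column \<open>x\<close> and the row \<open>z\<close>; its columns are
  the \<open>x\<close>-parts of the logarithms in \<open>\<Psi>\<^sub>1\<close>.\<close>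

definition outer :: "real ^ 'k \<Rightarrow> real ^ 'k \<Rightarrow> real ^ 'k ^ 'k::finite" where
  "outer x z = (\<chi> i j. z $ j * x $ i)"

lemma column_outer: "column j (outer x z) = z $ j *\<^sub>R x"
  by (simp add: outer_def column_def vec_eq_iff)

lemma outer_mult: "outer x z *v v = (z \<bullet> v) *\<^sub>R x"
  by (simp add: outer_def matrix_vector_mult_def inner_vec_def vec_eq_iff sum_distrib_left mult_ac)

lemma outer_comm: "(z \<bullet> v) *\<^sub>R (outer x z *v w) = (z \<bullet> w) *\<^sub>R (outer x z *v v)"
  by (simp add: outer_mult)

lemma Psi1_eq: "\<Psi>\<^sub>1 (x, Y, z) = gens (lin_hom (outer x z) Y z)"
  by (simp add: \<Psi>\<^sub>1_def gens_lin_hom column_outer)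

lemma Psi2_eq: "\<Psi>\<^sub>2 (X, Y) = gens (lin_hom X Y 0)"
  by (simp add: \<Psi>\<^sub>2_def gens_lin_hom)

text \<open>Transposing turns rank \<open>CARD('k)\<close> into full column rank, that is,
  injectivity of the map stacking \<open>Y *v v\<close> on \<open>z \<bullet> v\<close>.\<close>

lemma rank_append_col_iff:
  fixes Y :: "real ^ 'k ^ 'k::finite"
  shows "rank (append_col (transpose Y) z) = CARD('k) \<longleftrightarrow>
    (\<forall>v. z \<bullet> v = 0 \<and> Y *v v = 0 \<longrightarrow> v = 0)"
proof -
  let ?A = "transpose (append_col (transpose Y) z)"
  have "(?A *v v) $ Some i = (Y *v v) $ i" "(?A *v v) $ None = z \<bullet> v" for v i
    by (simp_all add: matrix_vector_mult_def transpose_def append_col_def inner_vec_def)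
  then have A0: "?A *v v = 0 \<longleftrightarrow> z \<bullet> v = 0 \<and> Y *v v = 0" for v
    unfolding vec_eq_iff by (metis option.exhaust zero_index)
  have "rank (append_col (transpose Y) z) = rank ?A" by (rule rank_transpose[symmetric])
  also have "rank ?A = CARD('k) \<longleftrightarrow> inj ((*v) ?A)" by (rule full_rank_injective)
  also have "\<dots> \<longleftrightarrow> (\<forall>v. ?A *v v = 0 \<longrightarrow> v = 0)"
    by (rule linear_injective_0) (rule matrix_vector_mul_linear)
  finally show ?thesis by (simp only: A0)
qed

text \<open>On the kernel of \<open>z\<close> the matrix \<open>outer x z\<close> vanishes, so
  \<open>s\<close> drops out.\<close>

lemma nondegenerate_outer_iff:
  fixes Y :: "real ^ 'k ^ 'k::finite"
  shows "nondegenerate (outer x z) Y z \<longleftrightarrow> rank (append_col (transpose Y) z) = CARD('k)"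
  unfolding nondegenerate_def rank_append_col_iff by (simp add: outer_mult cong: conj_cong)

lemma nondegenerate_zero_iff:
  fixes X Y :: "real ^ 'k ^ 'k::finite"
  shows "nondegenerate X Y 0 \<longleftrightarrow> (\<forall>l. det (Y - l *\<^sub>R X) \<noteq> 0)"
proof -
  have "det (Y - l *\<^sub>R X) \<noteq> 0 \<longleftrightarrow> (\<forall>v. Y *v v + (- l) *\<^sub>R (X *v v) = 0 \<longrightarrow> v = 0)" for l
  proof -
    have "(Y - l *\<^sub>R X) *v v = Y *v v + (- l) *\<^sub>R (X *v v)" for v
      by (simp add: matrix_vector_mult_diff_rdistrib flip: scaleR_matrix_vector_assoc)
    moreover have "det (Y - l *\<^sub>R X) \<noteq> 0 \<longleftrightarrow> inj ((*v) (Y - l *\<^sub>R X))"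
      by (metis det_nz_iff_inj matrix_of_matrix_vector_mul matrix_vector_mul_linear)
    moreover have "\<dots> \<longleftrightarrow> (\<forall>v. (Y - l *\<^sub>R X) *v v = 0 \<longrightarrow> v = 0)"
      by (rule linear_injective_0) (rule matrix_vector_mul_linear)
    ultimately show ?thesis by simp
  qed
  then show ?thesis
    unfolding nondegenerate_def by (metis inner_zero_left minus_minus)
qed

section \<open>Classification of homomorphisms and the bijection\<close>

lemma hom_cases:
  fixes \<phi> :: "int ^ 'k::finite \<Rightarrow> 'k gmat"
  assumes "\<phi> \<in> hom Gamma nilG"
  obtains (outer) x Y z where "z \<noteq> 0" "\<phi> = lin_hom (outer x z) Y z"
  | (zero) X Y where "\<phi> = lin_hom X Y 0"
proof -
  have "\<forall>j. \<exists>x y z. \<phi> (axis j 1) = gelt x y z"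
    using hom_in_carrier[OF assms] by (auto simp: Gamma_def carrier_nilG_gelt)
  then obtain xs ys zs where g: "\<And>j. \<phi> (axis j 1) = gelt (xs j) (ys j) (zs j)"
    by metis
  have mult: "\<phi> (m + n) = \<phi> m ** \<phi> n" for m n
    using hom_mult[OF assms, of m n] by (simp add: Gamma_def nilG_def)
  \<comment> \<open>The images of basis vectors commute because the lattice is abelian.\<close>
  have comm: "zs i *\<^sub>R xs j = zs j *\<^sub>R xs i" for i j
    using mult[of "axis i 1" "axis j 1"] mult[of "axis j 1" "axis i 1"]
    by (simp add: add.commute g flip: gelt_commute_iff[of _ "ys i" _ _ "ys j"])
  define X :: "real ^ 'k ^ 'k" where "X = (\<chi> i j. xs j $ i)"
  define Y :: "real ^ 'k ^ 'k" where "Y = (\<chi> i j. ys j $ i)"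
  define z where "z = (\<chi> j. zs j)"
  have cols: "column j X = xs j" "column j Y = ys j" "z $ j = zs j" for j
    by (simp_all add: X_def Y_def z_def column_def vec_eq_iff)
  show ?thesis
  proof (cases "z = 0")
    case True
    then have "gens \<phi> = gens (lin_hom X Y 0)"
      using cols(3) by (simp add: gens_lin_hom cols) (simp add: gens_def g)
    then show ?thesis using zero hom_eq_lin_hom_iff[OF assms, of 0 X Y] by simp
  next
    case False
    then obtain i where i: "zs i \<noteq> 0" by (auto simp: z_def vec_eq_iff)
    \<comment> \<open>Reading \<open>comm\<close> at an index with \<open>zs i \<noteq> 0\<close>
      makes every \<open>xs j\<close> a multiple of this vector.\<close>
    define x where "x = xs i /\<^sub>R zs i"
    have "xs j = zs j *\<^sub>R x" for j
    proof -
      have "zs j *\<^sub>R x = (zs i *\<^sub>R xs j) /\<^sub>R zs i" by (simp add: x_def comm[of i j])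
      then show ?thesis using i by simp
    qed
    then have "gens \<phi> = gens (lin_hom (outer x z) Y z)"
      by (simp add: gens_lin_hom column_outer cols) (simp add: gens_def g)
    then show ?thesis
      using outer False hom_eq_lin_hom_iff[OF assms outer_comm] by blast
  qed
qed

lemma gens_lin_hom_eq_iff:
  "gens (lin_hom X Y z) = gens (lin_hom X' Y' z') \<longleftrightarrow> X = X' \<and> Y = Y' \<and> z = z'"
  by (simp add: gens_lin_hom fun_eq_iff gelt_eq_iff) (auto simp: vec_eq_iff column_def)

lemma outer_eq_iff:
  assumes "z \<noteq> 0"
  shows "outer x z = outer x' z \<longleftrightarrow> x = x'"
  using assms by (auto simp: outer_def vec_eq_iff)

theorem theorem2p1:
  "bij_betw (case_sum \<Psi>\<^sub>1 \<Psi>\<^sub>2) (M\<^sub>1\<^sub>r <+> M\<^sub>2\<^sub>r)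
     (gens ` (R_set :: (int ^ 'k::finite \<Rightarrow> 'k gmat) set))"
proof (rule bij_betw_imageI)
  show "inj_on (case_sum \<Psi>\<^sub>1 \<Psi>\<^sub>2) (M\<^sub>1\<^sub>r <+> (M\<^sub>2\<^sub>r :: ((real ^ 'k ^ 'k) \<times> (real ^ 'k ^ 'k)) set))"
    \<comment> \<open>The images of the two families are disjoint since \<open>z\<close> is nonzero
      in the first and zero in the second; within the first, \<open>z \<noteq> 0\<close> lets
      \<open>outer x z\<close> determine \<open>x\<close>.\<close>
    by (auto simp: inj_on_def M\<^sub>1\<^sub>r_def Psi1_eq Psi2_eq gens_lin_hom_eq_iff outer_eq_iff)
  have M1: "(x, Y, z) \<in> M\<^sub>1\<^sub>r \<longleftrightarrow> z \<noteq> 0 \<and> lin_hom (outer x z) Y z \<in> R_set"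
    for x z :: "real ^ 'k" and Y
    by (simp add: M\<^sub>1\<^sub>r_def lin_hom_in_R_set_iff[OF outer_comm] nondegenerate_outer_iff)
  have M2: "(X, Y) \<in> M\<^sub>2\<^sub>r \<longleftrightarrow> lin_hom X Y 0 \<in> R_set" for X Y :: "real ^ 'k ^ 'k"
    by (simp add: M\<^sub>2\<^sub>r_def lin_hom_in_R_set_iff nondegenerate_zero_iff)
  show "case_sum \<Psi>\<^sub>1 \<Psi>\<^sub>2 ` (M\<^sub>1\<^sub>r <+> M\<^sub>2\<^sub>r) = gens ` (R_set :: (int ^ 'k \<Rightarrow> 'k gmat) set)"
  proof (intro equalityI subsetI)
    fix g :: "'k \<Rightarrow> 'k gmat"
    assume "g \<in> case_sum \<Psi>\<^sub>1 \<Psi>\<^sub>2 ` (M\<^sub>1\<^sub>r <+> M\<^sub>2\<^sub>r)"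
    then show "g \<in> gens ` R_set" by (auto simp: M1 M2 Psi1_eq Psi2_eq)
  next
    fix g :: "'k \<Rightarrow> 'k gmat"
    assume "g \<in> gens ` R_set"
    then obtain \<phi> where \<phi>: "\<phi> \<in> R_set" "g = gens \<phi>" by blast
    then have "\<phi> \<in> hom Gamma nilG" by (simp add: R_set_def)
    then show "g \<in> case_sum \<Psi>\<^sub>1 \<Psi>\<^sub>2 ` (M\<^sub>1\<^sub>r <+> M\<^sub>2\<^sub>r)"
    proof (cases rule: hom_cases)
      case (outer x Y z)
      then have "g = case_sum \<Psi>\<^sub>1 \<Psi>\<^sub>2 (Inl (x, Y, z))" "(x, Y, z) \<in> M\<^sub>1\<^sub>r"
        using \<phi> by (simp_all add: M1 Psi1_eq)
      then show ?thesis by blast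
    next
      case (zero X Y)
      then have "g = case_sum \<Psi>\<^sub>1 \<Psi>\<^sub>2 (Inr (X, Y))" "(X, Y) \<in> M\<^sub>2\<^sub>r"
        using \<phi> by (simp_all add: M2 Psi2_eq)
      then show ?thesis by blast
    qed
  qed
qed

end
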